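(* Let $A\in\mathbb{R}^{d\times d}$, let $B\in\mathbb{R}^{d\times d}$ be symmetric positive definite, and let $(v^k)_{k\in\mathbb{N}}$ be the sequence generated by the one-sample zeroth-order method (Algorithm 1, described in the context). If $\dim(G_{\max})<d-1$, then almost surely $v^k$ is not a generalized eigenvector of $(A^{\mathrm H},B)$ for all $k\in\mathbb{N}$. In other words, almost surely the algorithm does not terminate.
   Context: $\mathbb{N}$ includes $0$. $\langle\cdot,\cdot\rangle$ and $\|\cdot\|$ are the Euclidean inner product and norm. Put $A^{\mathrm H}=\tfrac12(A+A^{\mathrm T})$, $\|v\|_B=\sqrt{\langle v,Bv\rangle}$, $\mathbb{S}_B^{d-1}=\{v\in\mathbb{R}^d:\|v\|_B=1\}$. For $v\in\mathbb{S}_B^{d-1}$ let $T_v=\{x\in\mathbb{R}^d:\langle x,Bv\rangle=0\}$ and let $P_v y=y-\frac{\langle y,Bv\rangle}{\|Bv\|^2}Bv$ be the Euclidean orthogonal projection onto $T_v$. The generalized Rayleigh quotient is $r(A,B,v)=\frac{\langle v,Av\rangle}{\langle v,Bv\rangle}$ for $v\ne0$, and $\mathcal{R}(A,B)=\max_{v\neq 0} r(A,B,v)$. A number $\lambda\in\mathbb{R}$ is a generalized eigenvalue of $(A^{\mathrm H},B)$, with generalized eigenvector $v\neq0$, if $A^{\mathrm H}v=\lambda Bv$; $G_\lambda=\{v\in\mathbb{R}^d\setminus\{0\}:A^{\mathrm H}v=\lambda Bv\}$, and $\dim(G_\lambda)$ denotes the dimension of the linear subspace $G_\lambda\cup\{0\}$.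 $\mathcal{R}(A,B)$ is the largest generalized eigenvalue and $G_{\max}=G_{\mathcal{R}(A,B)}$. Algorithm 1: Initialize $v^0=\tilde v/\|\tilde v\|_B$ with $\tilde v\sim\mathcal{N}(0,I_d)$. For $k=0,1,2,\dots$: sample $\tilde x\sim\mathcal{N}(0,I_d)$ independently of everything before and set $x^k=P_{v^k}\tilde x/\|P_{v^k}\tilde x\|$; if $\langle x^k,A^{\mathrm H}v^k\rangle=0$, stop (terminate; no further iterates are generated); otherwise let $\tau_k=\operatorname{argmax}_{\tau\in\mathbb{R}} r(A,B,v^k+\tau x^k)$ (the maximizer exists and is unique in this case) and set $v^{k+1}=\frac{v^k+\tau_kx^k}{\|v^k+\tau_kx^k\|_B}$. *)

theory Defs
  imports "HOL-Probability.Probability"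
begin

definition sym_pos_def :: "real ^ 'n ^ 'n \<Rightarrow> bool" where
  "sym_pos_def B \<longleftrightarrow> transpose B = B \<and> (\<forall>v. v \<noteq> 0 \<longrightarrow> v \<bullet> (B *v v) > 0)"

definition sym_part :: "real ^ 'n ^ 'n \<Rightarrow> real ^ 'n ^ 'n" where
  "sym_part A = (1 / 2) *\<^sub>R (A + transpose A)"

definition norm_wrt :: "real ^ 'n ^ 'n \<Rightarrow> real ^ 'n \<Rightarrow> real" where
  "norm_wrt B v = sqrt (v \<bullet> (B *v v))"

definition rayleigh :: "real ^ 'n ^ 'n \<Rightarrow> real ^ 'n ^ 'n \<Rightarrow> real ^ 'n \<Rightarrow> real" where
  "rayleigh A B v = (v \<bullet> (A *v v)) / (v \<bullet> (B *v v))"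

definition rayleigh_max :: "real ^ 'n ^ 'n \<Rightarrow> real ^ 'n ^ 'n \<Rightarrow> real" where
  "rayleigh_max A B = (GREATEST m. \<exists>v. v \<noteq> 0 \<and> m = rayleigh A B v)"

definition gen_eigenvectors ::
    "real ^ 'n ^ 'n \<Rightarrow> real ^ 'n ^ 'n \<Rightarrow> real \<Rightarrow> (real ^ 'n) set" where
  "gen_eigenvectors A B l = {v. v \<noteq> 0 \<and> sym_part A *v v = l *\<^sub>R (B *v v)}"

definition is_gen_eigenvector ::
    "real ^ 'n ^ 'n \<Rightarrow> real ^ 'n ^ 'n \<Rightarrow> real ^ 'n \<Rightarrow> bool" where
  "is_gen_eigenvector A B v \<longleftrightarrow> (\<exists>l. v \<in> gen_eigenvectors A B l)"

definition G_max :: "real ^ 'n ^ 'n \<Rightarrow> real ^ 'n ^ 'n \<Rightarrow> (real ^ 'n) set" where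
  "G_max A B = gen_eigenvectors A B (rayleigh_max A B)"

definition tangent_proj :: "real ^ 'n ^ 'n \<Rightarrow> real ^ 'n \<Rightarrow> real ^ 'n \<Rightarrow> real ^ 'n" where
  "tangent_proj B v y = y - ((y \<bullet> (B *v v)) / (norm (B *v v))\<^sup>2) *\<^sub>R (B *v v)"

(* If the projection of the sample y is 0, the direction is 0 by the convention
   inverse 0 = 0, and the stopping test below then succeeds. *)
definition search_dir :: "real ^ 'n ^ 'n \<Rightarrow> real ^ 'n \<Rightarrow> real ^ 'n \<Rightarrow> real ^ 'n" where
  "search_dir B v y = tangent_proj B v y /\<^sub>R norm (tangent_proj B v y)"

definition stops ::
    "real ^ 'n ^ 'n \<Rightarrow> real ^ 'n \<Rightarrow> real ^ 'n \<Rightarrow> bool" where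
  "stops A v x \<longleftrightarrow> x \<bullet> (sym_part A *v v) = 0"

definition opt_step ::
    "real ^ 'n ^ 'n \<Rightarrow> real ^ 'n ^ 'n \<Rightarrow> real ^ 'n \<Rightarrow> real ^ 'n \<Rightarrow> real" where
  "opt_step A B v x = arg_max (\<lambda>t. rayleigh A B (v + t *\<^sub>R x)) (\<lambda>_. True)"

definition next_iterate ::
    "real ^ 'n ^ 'n \<Rightarrow> real ^ 'n ^ 'n \<Rightarrow> real ^ 'n \<Rightarrow> real ^ 'n \<Rightarrow> real ^ 'n" where
  "next_iterate A B v x =
    (let w = v + opt_step A B v x *\<^sub>R x in w /\<^sub>R norm_wrt B w)"

(* One run of the algorithm for the realised samples u (initial vector) and
   y 0, y 1, ... (one per iteration). The value None at k means that the run has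
   stopped before producing a k-th iterate. *)
primrec iterate ::
    "real ^ 'n ^ 'n \<Rightarrow> real ^ 'n ^ 'n \<Rightarrow> real ^ 'n \<Rightarrow> (nat \<Rightarrow> real ^ 'n) \<Rightarrow> nat \<Rightarrow> (real ^ 'n) option"
where
  "iterate A B u y 0 = Some (u /\<^sub>R norm_wrt B u)"
| "iterate A B u y (Suc k) =
    (case iterate A B u y k of
       None \<Rightarrow> None
     | Some v \<Rightarrow>
         (let x = search_dir B v (y k)
          in if stops A v x then None else Some (next_iterate A B v x)))"

definition terminates ::
    "real ^ 'n ^ 'n \<Rightarrow> real ^ 'n ^ 'n \<Rightarrow> real ^ 'n \<Rightarrow> (nat \<Rightarrow> real ^ 'n) \<Rightarrow> bool" where
  "terminates A B u y \<longleftrightarrow>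
    (\<exists>k v. iterate A B u y k = Some v \<and> stops A v (search_dir B v (y k)))"

definition std_gaussian_density :: "real ^ 'n \<Rightarrow> ennreal" where
  "std_gaussian_density x = ennreal (\<Prod>i\<in>UNIV. std_normal_density (x $ i))"

end

theory Submission
  imports Defs
begin

text \<open>
  If \<open>v\<close> is not an eigenvector, then \<open>A\<^sup>Hv\<close> is not a multiple of \<open>Bv\<close>, so the stopping
  test succeeds only for samples in a hyperplane. Let \<open>E\<close> be an eigenspace. If
  \<open>dim E \<le> d - 2\<close>, then \<open>span (E \<union> {v})\<close> lies in a hyperplane with some normal \<open>a\<close>; since
  \<open>a \<bottom> v\<close>, the vector \<open>a\<close> is not a multiple of \<open>Bv\<close>, so the search line meets \<open>E\<close> only
  for samples orthogonal to \<open>P\<^sub>v a \<noteq> 0\<close>. If \<open>dim E = d - 1\<close>, the eigenvalue of \<open>E\<close> is not the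
  maximal one, hence it is the minimum of the Rayleigh quotient, attained only on \<open>E\<close>, and the
  line search never moves into \<open>E\<close>. There are finitely many eigenvalues, so for a fixed
  non-eigenvector the bad samples form a null set. The line search has a closed-form solution,
  which makes the iterates measurable functions of the previous samples, and Fubini transfers the
  fixed-\<open>v\<close> statement to the random iterate.
\<close>

section \<open>Symmetric part and generalized eigenspaces\<close>

lemma inner_mult_transpose:
  fixes M :: "real ^ 'n ^ 'n"
  shows "x \<bullet> (M *v y) = (transpose M *v x) \<bullet> y"
  by (simp add: transpose_matrix_vector dot_lmul_matrix)

lemma transpose_sym_part: "transpose (sym_part A) = sym_part A"
  by (simp add: sym_part_def transpose_def vec_eq_iff add.commute)

text \<open>The antisymmetric part of \<open>A\<close> contributes nothing to the quadratic form, so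
  \<open>rayleigh\<close>, stated with \<open>A\<close>, can be computed from the symmetric
  part.\<close>

lemma quadratic_sym_part: "v \<bullet> (sym_part A *v v) = v \<bullet> (A *v v)"
proof -
  have "v \<bullet> (transpose A *v v) = v \<bullet> (A *v v)"
    by (simp add: inner_mult_transpose[of v A] inner_commute)
  then show ?thesis
    by (simp add: sym_part_def scaleR_matrix_vector_assoc[symmetric] matrix_vector_mult_add_rdistrib
        inner_add_right)
qed

text \<open>Unlike \<open>gen_eigenvectors\<close> it contains 0, which makes it a subspace for
  every real \<open>l\<close>.\<close>

definition gen_eigenspace :: "real ^ 'n ^ 'n \<Rightarrow> real ^ 'n ^ 'n \<Rightarrow> real \<Rightarrow> (real ^ 'n) set" where
  "gen_eigenspace S B l = {v. S *v v = l *\<^sub>R (B *v v)}"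

lemma gen_eigenspace_kernel: "gen_eigenspace S B l = {v. (S - l *\<^sub>R B) *v v = 0}"
  by (simp add: gen_eigenspace_def matrix_vector_mult_diff_rdistrib scaleR_matrix_vector_assoc[symmetric])

lemma subspace_gen_eigenspace: "subspace (gen_eigenspace S B l)"
  unfolding gen_eigenspace_kernel
  by (rule linear_subspace_kernel) (simp add: matrix_vector_mul_linear)

lemma gen_eigenvectors_eq: "gen_eigenvectors A B l = gen_eigenspace (sym_part A) B l - {0}"
  by (auto simp: gen_eigenvectors_def gen_eigenspace_def)

lemma dim_gen_eigenvectors:
  "dim (gen_eigenvectors A B l \<union> {0}) = dim (gen_eigenspace (sym_part A) B l)"
proof -
  have "0 \<in> gen_eigenspace (sym_part A) B l"
    by (rule subspace_0[OF subspace_gen_eigenspace])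
  then have "gen_eigenvectors A B l \<union> {0} = gen_eigenspace (sym_part A) B l"
    by (auto simp: gen_eigenvectors_eq)
  then show ?thesis by simp
qed

text \<open>Eigenvectors for different generalized eigenvalues are \<open>B\<close>-orthogonal.\<close>

lemma finite_gen_eigenvalues:
  fixes S B :: "real ^ 'n ^ 'n"
  assumes S: "transpose S = S" and B: "sym_pos_def B"
  shows "finite {l. gen_eigenspace S B l \<noteq> {0}}" (is "finite ?L")
proof -
  have tB: "transpose B = B" and pB: "\<And>v. v \<noteq> 0 \<Longrightarrow> v \<bullet> (B *v v) > 0"
    using B by (auto simp: sym_pos_def_def)
  have "\<exists>v. v \<in> gen_eigenspace S B l \<and> v \<noteq> 0" if "l \<in> ?L" for l
    using that subspace_0[OF subspace_gen_eigenspace[of S B l]] by auto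
  then obtain g where g: "\<And>l. l \<in> ?L \<Longrightarrow> g l \<in> gen_eigenspace S B l \<and> g l \<noteq> 0"
    by metis
  have orth: "g l \<bullet> (B *v g m) = 0" if "l \<in> ?L" "m \<in> ?L" "l \<noteq> m" for l m
  proof -
    have "m * (g l \<bullet> (B *v g m)) = g l \<bullet> (S *v g m)"
      using g[OF that(2)] by (simp add: gen_eigenspace_def)
    also have "\<dots> = (S *v g l) \<bullet> g m"
      by (simp add: inner_mult_transpose[of _ S] S)
    also have "\<dots> = l * (g l \<bullet> (B *v g m))"
      using g[OF that(1)] by (simp add: gen_eigenspace_def inner_mult_transpose[of _ B] tB)
    finally show ?thesis using that(3) by simp
  qed
  \<comment> \<open>Two eigenvalues sharing a vector would make it \<open>B\<close>-orthogonal to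
    itself, against positivity.\<close>
  have inj: "inj_on g ?L"
    by (rule inj_onI) (metis orth g pB less_irrefl)
  have "independent (g ` ?L)"
    unfolding independent_explicit_finite_subsets
  proof (intro allI impI ballI)
    fix T u w
    assume T: "T \<subseteq> g ` ?L" "finite T" and sum: "(\<Sum>w\<in>T. u w *\<^sub>R w) = 0" and w: "w \<in> T"
    \<comment> \<open>Pairing the relation with \<open>B *v w\<close> isolates the coefficient of
      \<open>w\<close>.\<close>
    have "0 = (\<Sum>x\<in>T. u x *\<^sub>R x) \<bullet> (B *v w)" by (simp add: sum)
    also have "\<dots> = (\<Sum>x\<in>T. u x * (x \<bullet> (B *v w)))" by (simp add: inner_sum_left)
    also have "\<dots> = (\<Sum>x\<in>T. if x = w then u w * (w \<bullet> (B *v w)) else 0)"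
    proof (rule sum.cong)
      fix x assume "x \<in> T"
      then obtain l m where "l \<in> ?L" "m \<in> ?L" "x = g l" "w = g m" using T w by blast
      then show "u x * (x \<bullet> (B *v w)) = (if x = w then u w * (w \<bullet> (B *v w)) else 0)"
        using orth by (metis mult_zero_right)
    qed simp
    also have "\<dots> = u w * (w \<bullet> (B *v w))" using T w by simp
    finally show "u w = 0" using pB[of w] g T w by force
  qed
  then have "finite (g ` ?L)" by (rule independent_imp_finite)
  then show ?thesis using inj finite_imageD by blast
qed

text \<open>The form \<open>S - lB\<close> has rank one, so it is \<open>\<kappa> \<langle>n,\<cdot>\<rangle>\<^sup>2\<close>; if \<open>\<kappa> \<le> 0\<close>, then
  \<open>l\<close> would be the maximum of the Rayleigh quotient.\<close>

lemma rayleigh_gt_codim1_eigenvalue: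
  fixes A B :: "real ^ 'n ^ 'n"
  assumes B: "sym_pos_def B"
    and dim: "dim (gen_eigenspace (sym_part A) B l) = CARD('n) - 1"
    and neq: "gen_eigenspace (sym_part A) B l \<noteq> {0}" and l: "l \<noteq> rayleigh_max A B"
    and v: "v \<notin> gen_eigenspace (sym_part A) B l"
  shows "rayleigh A B v > l"
proof -
  let ?E = "gen_eigenspace (sym_part A) B l"
  define C where "C = sym_part A - l *\<^sub>R B"
  have tB: "transpose B = B" and pB: "\<And>v. v \<noteq> 0 \<Longrightarrow> v \<bullet> (B *v v) > 0"
    using B by (auto simp: sym_pos_def_def)
  have tC: "transpose C = C"
    using tB transpose_sym_part[of A] by (simp add: C_def transpose_def vec_eq_iff)
  have E: "?E = {v. C *v v = 0}" by (simp add: gen_eigenspace_kernel C_def)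
  have qC: "z \<bullet> (C *v z) = z \<bullet> (A *v z) - l * (z \<bullet> (B *v z))" for z
    by (simp add: C_def matrix_vector_mult_diff_rdistrib scaleR_matrix_vector_assoc[symmetric]
        inner_diff_right quadratic_sym_part)
  obtain n where n: "n \<noteq> 0" "span ?E = {x. n \<bullet> x = 0}"
    using lowdim_eq_hyperplane[of ?E] dim by auto
  have En: "?E = {x. n \<bullet> x = 0}"
    using n span_eq_iff[of ?E] subspace_gen_eigenspace by auto
  define k where "k = (n \<bullet> (C *v n)) / (n \<bullet> n)\<^sup>2"
  have nn: "n \<bullet> n > 0" using n by simp
  have form: "z \<bullet> (C *v z) = k * (n \<bullet> z)\<^sup>2" for z
  proof -
    \<comment> \<open>This \<open>s\<close> makes \<open>z\<close> minus its
      \<open>n\<close>-component orthogonal to \<open>n\<close>, hence an element of the kernel of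
      \<open>C\<close>.\<close>
    define s where "s = (n \<bullet> z) / (n \<bullet> n)"
    have "n \<bullet> (z - s *\<^sub>R n) = 0" using nn by (simp add: s_def inner_diff_right)
    then have "C *v (z - s *\<^sub>R n) = 0" using En E by blast
    then have Cz: "C *v z = s *\<^sub>R (C *v n)"
      by (simp add: matrix_vector_mult_diff_distrib matrix_vector_mult_scaleR)
    have "z \<bullet> (C *v z) = s * (z \<bullet> (C *v n))" by (simp add: Cz)
    also have "\<dots> = s * ((C *v z) \<bullet> n)" by (simp add: inner_mult_transpose[of _ C] tC)
    also have "\<dots> = s * s * (n \<bullet> (C *v n))" by (simp add: Cz inner_commute)
    also have "\<dots> = k * (n \<bullet> z)\<^sup>2" by (simp add: s_def k_def power2_eq_square)
    finally show ?thesis .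
  qed
  have "k > 0"
  proof (rule ccontr)
    assume k: "\<not> k > 0"
    have le: "rayleigh A B z \<le> l" if "z \<noteq> 0" for z
    proof -
      have "k * (n \<bullet> z)\<^sup>2 \<le> 0" using k by (simp add: mult_nonpos_nonneg)
      then have "z \<bullet> (A *v z) \<le> l * (z \<bullet> (B *v z))" using form[of z] qC[of z] by simp
      then show ?thesis using pB[OF that] by (simp add: rayleigh_def divide_le_eq)
    qed
    obtain e where e: "e \<in> ?E" "e \<noteq> 0"
      using neq subspace_0[OF subspace_gen_eigenspace[of "sym_part A" B l]] by auto
    have "e \<bullet> (C *v e) = 0" using e E by simp
    then have "rayleigh A B e = l" using pB[OF e(2)] qC[of e] by (simp add: rayleigh_def)
    then have "rayleigh_max A B = l"
      unfolding rayleigh_max_def using le e by (intro Greatest_equality) auto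
    then show False using l by simp
  qed
  moreover have "n \<bullet> v \<noteq> 0" using v En by simp
  ultimately have "v \<bullet> (C *v v) > 0" by (simp add: form)
  moreover have "v \<noteq> 0" using v subspace_0[OF subspace_gen_eigenspace] by metis
  ultimately show ?thesis using qC[of v] pB[of v] by (simp add: rayleigh_def less_divide_eq)
qed

section \<open>Exact line search\<close>

text \<open>With \<open>m\<close> the positive root of \<open>pqm\<^sup>2 - (aq - cp)m - b\<^sup>2\<close>, the numerator
  \<open>a + 2bt + ct\<^sup>2 - (c/q + m)(p + qt\<^sup>2)\<close> is a negative multiple of a square.\<close>

definition step_value :: "real \<Rightarrow> real \<Rightarrow> real \<Rightarrow> real \<Rightarrow> real \<Rightarrow> real" where
  "step_value a b c p q =
    ((a * q - c * p) + sqrt ((a * q - c * p)\<^sup>2 + 4 * p * q * b\<^sup>2)) / (2 * p * q)"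

lemma quotient_less_optimum:
  fixes a b c p q t :: real
  assumes p: "p > 0" and q: "q > 0" and b: "b \<noteq> 0"
  defines "m \<equiv> step_value a b c p q"
  assumes t: "t \<noteq> b / (m * q)"
  shows "(a + 2 * b * t + c * t\<^sup>2) / (p + q * t\<^sup>2)
    < (a + 2 * b * (b / (m * q)) + c * (b / (m * q))\<^sup>2) / (p + q * (b / (m * q))\<^sup>2)"
proof -
  define e where "e = a * q - c * p"
  define D where "D = e\<^sup>2 + 4 * p * q * b\<^sup>2"
  have "4 * p * q * b\<^sup>2 > 0" using p q b by simp
  then have D: "D > e\<^sup>2" by (simp add: D_def)
  have "\<bar>e\<bar> = sqrt (e\<^sup>2)" by simp
  also have "\<dots> < sqrt D" using D by (rule real_sqrt_less_mono)
  finally have "e + sqrt D > 0" by linarith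
  moreover have m: "m = (e + sqrt D) / (2 * p * q)" by (simp add: m_def step_value_def e_def D_def)
  ultimately have mpos: "m > 0" using p q by simp
  have s: "sqrt D = 2 * p * q * m - e" using m p q by (simp add: field_simps)
  have "D \<ge> 0" using D by (smt (verit) zero_le_power2)
  then have "(2 * p * q * m - e)\<^sup>2 = D" unfolding s[symmetric] by simp
  then have "4 * p * q * (p * q * m\<^sup>2 - e * m - b\<^sup>2) = 0"
    unfolding D_def by (simp add: power2_eq_square algebra_simps)
  then have root: "p * q * m\<^sup>2 - e * m = b\<^sup>2" using p q by simp
  \<comment> \<open>Completing the square: the quotient is \<open>c / q + m\<close> minus a
    nonnegative term that vanishes only at \<open>s = b / (m * q)\<close>.\<close>
  have val: "(a + 2 * b * s + c * s\<^sup>2) / (p + q * s\<^sup>2) = c / q + m - m * q * (s - b / (m * q))\<^sup>2 / (p + q * s\<^sup>2)"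
    for s
  proof -
    have pos: "p + q * s\<^sup>2 > 0" using p q by (simp add: add_pos_nonneg)
    have "b\<^sup>2 / (m * q) = p * m - e / q"
      using root mpos q by (simp add: field_simps power2_eq_square)
    then have r: "b\<^sup>2 / (m * q) = p * m - a + c * p / q" using q by (simp add: e_def field_simps)
    have "m * q * (s - b / (m * q))\<^sup>2 = m * q * s\<^sup>2 - 2 * b * s + b\<^sup>2 / (m * q)"
      using mpos q by (simp add: field_simps power2_eq_square)
    also have "\<dots> = (c / q + m) * (p + q * s\<^sup>2) - (a + 2 * b * s + c * s\<^sup>2)"
      unfolding r using q by (simp add: field_simps power2_eq_square)
    finally show ?thesis using pos by (simp add: field_simps)
  qed
  have "m * q * (t - b / (m * q))\<^sup>2 / (p + q * t\<^sup>2) > 0"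
    using mpos q p t by (intro divide_pos_pos mult_pos_pos add_pos_nonneg) auto
  then show ?thesis unfolding val by simp
qed

text \<open>An explicit maximizer, for the case that the stopping test fails, in place of the choice
  behind \<open>arg_max\<close>; measurability can be read off from it.\<close>

definition opt_step_formula ::
    "real ^ 'n ^ 'n \<Rightarrow> real ^ 'n ^ 'n \<Rightarrow> real ^ 'n \<Rightarrow> real ^ 'n \<Rightarrow> real" where
  "opt_step_formula A B v x =
    (let b = x \<bullet> (sym_part A *v v); q = x \<bullet> (B *v x)
     in b / (step_value (v \<bullet> (A *v v)) b (x \<bullet> (A *v x)) (v \<bullet> (B *v v)) q * q))"

text \<open>\<open>B\<close>-orthogonality of \<open>x\<close> and \<open>v\<close> removes the
  cross term from the denominator, so \<open>quotient_less_optimum\<close> applies along the line.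
  Its strict inequality makes the maximizer unique, which pins down \<open>arg_max\<close>;
  comparison with step 0 gives the monotonicity.\<close>

lemma
  fixes A B :: "real ^ 'n ^ 'n"
  assumes B: "sym_pos_def B" and v: "v \<noteq> 0" and x: "x \<bullet> (B *v v) = 0"
    and stops: "\<not> stops A v x"
  shows opt_step_eq_formula: "opt_step A B v x = opt_step_formula A B v x" (is ?eq)
    and rayleigh_le_opt_step: "rayleigh A B v \<le> rayleigh A B (v + opt_step A B v x *\<^sub>R x)" (is ?le)
proof -
  have tB: "transpose B = B" and pB: "\<And>v. v \<noteq> 0 \<Longrightarrow> v \<bullet> (B *v v) > 0"
    using B by (auto simp: sym_pos_def_def)
  let ?f = "\<lambda>t. rayleigh A B (v + t *\<^sub>R x)" and ?T = "opt_step_formula A B v x"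
  let ?b = "x \<bullet> (sym_part A *v v)"
  have x0: "x \<noteq> 0" and b0: "?b \<noteq> 0" using stops by (auto simp: stops_def)
  have xv: "v \<bullet> (B *v x) = 0"
    using x inner_mult_transpose[of v B x] by (simp add: tB inner_commute)
  have bv: "v \<bullet> (sym_part A *v x) = ?b"
    using inner_mult_transpose[of v "sym_part A" x] by (simp add: transpose_sym_part inner_commute)
  have num: "(v + t *\<^sub>R x) \<bullet> (A *v (v + t *\<^sub>R x)) = v \<bullet> (A *v v) + 2 * ?b * t + (x \<bullet> (A *v x)) * t\<^sup>2" for t
    unfolding quadratic_sym_part[where A = A, symmetric]
    by (simp add: matrix_vector_right_distrib matrix_vector_mult_scaleR inner_add_left inner_add_right bv
        power2_eq_square algebra_simps)
  have den: "(v + t *\<^sub>R x) \<bullet> (B *v (v + t *\<^sub>R x)) = v \<bullet> (B *v v) + (x \<bullet> (B *v x)) * t\<^sup>2" for t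
    by (simp add: matrix_vector_right_distrib matrix_vector_mult_scaleR inner_add_left inner_add_right x xv
        power2_eq_square algebra_simps)
  have less: "?f t < ?f ?T" if "t \<noteq> ?T" for t
    using quotient_less_optimum[OF pB[OF v] pB[OF x0] b0, of t "v \<bullet> (A *v v)" "x \<bullet> (A *v x)"] that
    unfolding rayleigh_def num den by (simp add: opt_step_formula_def Let_def)
  then have ismax: "is_arg_max ?f (\<lambda>_. True) ?T"
    unfolding is_arg_max_def by (metis less_asym less_irrefl)
  show ?eq
    unfolding opt_step_def arg_max_def
  proof (rule some_equality)
    show "is_arg_max ?f (\<lambda>_. True) ?T" by (rule ismax)
    fix t assume "is_arg_max ?f (\<lambda>_. True) t"
    then show "t = ?T" using less[of t] unfolding is_arg_max_def by blast
  qed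
  then show ?le using less[of 0] by (cases "?T = 0") auto
qed

section \<open>Null sets of samples\<close>

lemma AE_lborel_inner_nonzero:
  fixes a :: "'a::euclidean_space"
  assumes "a \<noteq> 0"
  shows "AE y in lborel. y \<bullet> a \<noteq> 0"
proof -
  have "{y. a \<bullet> y = 0} \<in> null_sets lborel"
    using negligible_hyperplane[of a 0] assms closed_hyperplane[of a 0]
    by (simp add: negligible_iff_null_sets null_sets_completion_iff)
  then have "AE y in lborel. y \<notin> {y. a \<bullet> y = 0}" by (rule AE_not_in)
  then show ?thesis by (simp add: inner_commute)
qed

lemma AE_lborel_notin_subspace:
  fixes E :: "'a::euclidean_space set"
  assumes "dim E < DIM('a)"
  shows "AE y in lborel. y \<notin> E"
proof -
  obtain a where a: "a \<noteq> 0" "span E \<subseteq> {x. a \<bullet> x = 0}"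
    using lowdim_subset_hyperplane[OF assms] by blast
  show ?thesis
    using AE_lborel_inner_nonzero[OF a(1)]
  proof eventually_elim
    case (elim y)
    then show ?case using a(2) span_base[of y E] by (auto simp: inner_commute)
  qed
qed

text \<open>The invariant of the run: nonzero and not a generalized eigenvector. Zero is excluded
  because it lies in every eigenspace.\<close>

definition in_no_eigenspace :: "real ^ 'n ^ 'n \<Rightarrow> real ^ 'n ^ 'n \<Rightarrow> real ^ 'n \<Rightarrow> bool" where
  "in_no_eigenspace A B v \<longleftrightarrow> (\<forall>l. v \<notin> gen_eigenspace (sym_part A) B l)"

lemma in_no_eigenspaceD:
  assumes "in_no_eigenspace A B v"
  shows "v \<noteq> 0" and "\<not> is_gen_eigenvector A B v" and "v \<notin> gen_eigenspace (sym_part A) B l"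
  using assms subspace_0[OF subspace_gen_eigenspace]
  by (auto simp: in_no_eigenspace_def is_gen_eigenvector_def gen_eigenvectors_eq)

text \<open>Replaces the quantifier over all reals by one over the generalized eigenvalues, so that
  unions of null sets and measurability become finite matters.\<close>

lemma in_no_eigenspace_iff_finite:
  "in_no_eigenspace A B v \<longleftrightarrow>
    v \<noteq> 0 \<and> (\<forall>l\<in>{l. gen_eigenspace (sym_part A) B l \<noteq> {0}}. v \<notin> gen_eigenspace (sym_part A) B l)"
  using in_no_eigenspaceD(1)[of A B v] by (auto simp: in_no_eigenspace_def)

lemma in_no_eigenspace_scaleR:
  assumes "c \<noteq> 0" "in_no_eigenspace A B v"
  shows "in_no_eigenspace A B (c *\<^sub>R v)"
proof -
  have "v \<in> gen_eigenspace (sym_part A) B l" if "c *\<^sub>R v \<in> gen_eigenspace (sym_part A) B l" for l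
    using subspace_scale[OF subspace_gen_eigenspace that, of "inverse c"] assms(1) by simp
  then show ?thesis using assms(2) by (auto simp: in_no_eigenspace_def)
qed

lemma norm_wrt_pos: "sym_pos_def B \<Longrightarrow> v \<noteq> 0 \<Longrightarrow> norm_wrt B v > 0"
  by (simp add: sym_pos_def_def norm_wrt_def)

lemma tangent_proj_orthogonal: "tangent_proj B v y \<bullet> (B *v v) = 0"
  by (cases "B *v v = 0") (simp_all add: tangent_proj_def inner_diff_left power2_norm_eq_inner)

lemma tangent_proj_selfadjoint: "tangent_proj B v y \<bullet> z = y \<bullet> tangent_proj B v z"
  by (simp add: tangent_proj_def inner_diff_left inner_diff_right inner_commute)

text \<open>Transfers non-orthogonality from the projection, which is linear in \<open>y\<close>, to
  the normalized direction. A zero projection gives 0 on both sides.\<close>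

lemma tangent_proj_eq_search_dir:
  "tangent_proj B v y = norm (tangent_proj B v y) *\<^sub>R search_dir B v y"
  by (cases "tangent_proj B v y = 0") (simp_all add: search_dir_def)

lemma search_dir_orthogonal: "search_dir B v y \<bullet> (B *v v) = 0"
  by (simp add: search_dir_def tangent_proj_orthogonal)

text \<open>The projection is self-adjoint, so the exceptional samples form the hyperplane
  orthogonal to the projection of \<open>a\<close>, which is nonzero since \<open>a\<close> is no
  multiple of \<open>B *v v\<close>.\<close>

lemma AE_tangent_proj_inner_nonzero:
  assumes "\<And>c. a \<noteq> c *\<^sub>R (B *v v)"
  shows "AE y in lborel. tangent_proj B v y \<bullet> a \<noteq> 0"
proof -
  have "tangent_proj B v a \<noteq> 0"
    using assms[of "(a \<bullet> (B *v v)) / (norm (B *v v))\<^sup>2"] by (simp add: tangent_proj_def)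
  then show ?thesis
    unfolding tangent_proj_selfadjoint by (rule AE_lborel_inner_nonzero)
qed

lemma AE_not_stops:
  assumes "in_no_eigenspace A B v"
  shows "AE y in lborel. \<not> stops A v (search_dir B v y)"
proof -
  have "AE y in lborel. tangent_proj B v y \<bullet> (sym_part A *v v) \<noteq> 0"
    using assms by (intro AE_tangent_proj_inner_nonzero) (auto simp: in_no_eigenspace_def gen_eigenspace_def)
  then show ?thesis
  proof eventually_elim
    case (elim y)
    then show ?case
      by (subst (asm) tangent_proj_eq_search_dir) (simp add: stops_def)
  qed
qed

lemma AE_line_avoids_subspace:
  fixes E :: "(real ^ 'n) set"
  assumes B: "sym_pos_def B" and v: "v \<noteq> 0" "v \<notin> E" and E: "subspace E" and dim: "dim E < CARD('n) - 1"
  shows "AE y in lborel. \<forall>t. v + t *\<^sub>R search_dir B v y \<notin> E"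
proof -
  have "dim (insert v E) < DIM(real ^ 'n)" using dim by (auto simp: dim_insert)
  then obtain a where a: "a \<noteq> 0" "span (insert v E) \<subseteq> {x. a \<bullet> x = 0}"
    using lowdim_subset_hyperplane by blast
  have av: "a \<bullet> v = 0" and aE: "\<And>w. w \<in> E \<Longrightarrow> a \<bullet> w = 0"
    using a(2) span_base[of _ "insert v E"] by auto
  have "AE y in lborel. tangent_proj B v y \<bullet> a \<noteq> 0"
  proof (rule AE_tangent_proj_inner_nonzero)
    fix c
    show "a \<noteq> c *\<^sub>R (B *v v)"
    proof
      assume c: "a = c *\<^sub>R (B *v v)"
      then have "c * (v \<bullet> (B *v v)) = 0" using av by (simp add: inner_commute)
      moreover have "v \<bullet> (B *v v) > 0" using B v by (simp add: sym_pos_def_def)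
      ultimately show False using a(1) c by simp
    qed
  qed
  then show ?thesis
  proof eventually_elim
    case (elim y)
    then have x: "a \<bullet> search_dir B v y \<noteq> 0"
      by (subst (asm) tangent_proj_eq_search_dir) (simp add: inner_commute)
    show ?case
    proof (intro allI notI)
      fix t assume w: "v + t *\<^sub>R search_dir B v y \<in> E"
      \<comment> \<open>The normal \<open>a\<close> annihilates \<open>v\<close> and
        \<open>E\<close> but not the search direction.\<close>
      then have "t = 0" using aE[OF w] av x by (simp add: inner_add_right)
      then show False using w v by simp
    qed
  qed
qed

text \<open>The eigenvalues of multiplicity at least \<open>d - 1\<close> are not the maximal one; the line search
  cannot reach them because it does not decrease the Rayleigh quotient.\<close>

lemma AE_optimal_point_in_no_eigenspace:
  fixes A B :: "real ^ 'n ^ 'n"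
  assumes B: "sym_pos_def B" and dim: "dim (G_max A B \<union> {0}) < CARD('n) - 1"
    and v: "in_no_eigenspace A B v"
  shows "AE y in lborel. in_no_eigenspace A B
    (v + opt_step A B v (search_dir B v y) *\<^sub>R search_dir B v y)"
proof -
  let ?E = "gen_eigenspace (sym_part A) B" and ?x = "search_dir B v"
  let ?w = "\<lambda>y. v + opt_step A B v (?x y) *\<^sub>R ?x y"
  have pB: "\<And>v. v \<noteq> 0 \<Longrightarrow> v \<bullet> (B *v v) > 0"
    using B by (auto simp: sym_pos_def_def)
  \<comment> \<open>The search direction is \<open>B\<close>-orthogonal to \<open>v\<close>, so
    pairing with \<open>B *v v\<close> leaves only the positive number
    \<open>v \<bullet> (B *v v)\<close>.\<close>
  have w0: "?w y \<noteq> 0" for y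
  proof
    assume "?w y = 0"
    then have "?w y \<bullet> (B *v v) = 0" by simp
    then show False
      using pB[OF in_no_eigenspaceD(1)[OF v]] by (simp add: inner_add_left search_dir_orthogonal)
  qed
  have avoid: "AE y in lborel. ?w y \<notin> ?E l" if l: "?E l \<noteq> {0}" for l
  proof (cases "dim (?E l) < CARD('n) - 1")
    case True
    from AE_line_avoids_subspace[OF B in_no_eigenspaceD(1,3)[OF v] subspace_gen_eigenspace True]
    show ?thesis by eventually_elim blast
  next
    case False
    \<comment> \<open>A full eigenspace would contain \<open>v\<close>; hence the dimension is
      exactly \<open>CARD('n) - 1\<close>.\<close>
    have "dim (?E l) \<noteq> DIM(real ^ 'n)"
    proof
      assume "dim (?E l) = DIM(real ^ 'n)"
      then have "?E l = UNIV"
        using dim_eq_full[of "?E l"] span_eq_iff[of "?E l"] subspace_gen_eigenspace by blast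
      then show False using in_no_eigenspaceD(3)[OF v] by blast
    qed
    then have d: "dim (?E l) = CARD('n) - 1"
      using False dim_subset_UNIV[of "?E l"] by simp
    have "l \<noteq> rayleigh_max A B"
      using False dim unfolding G_max_def dim_gen_eigenvectors by auto
    then have r: "rayleigh A B v > l"
      using rayleigh_gt_codim1_eigenvalue[OF B d l] in_no_eigenspaceD(3)[OF v] by blast
    show ?thesis
      using AE_not_stops[OF v]
    proof eventually_elim
      case (elim y)
      have "rayleigh A B v \<le> rayleigh A B (?w y)"
        using rayleigh_le_opt_step[OF B in_no_eigenspaceD(1)[OF v] search_dir_orthogonal elim] .
      \<comment> \<open>An eigenvector has its eigenvalue as Rayleigh quotient, here strictly below
        the value already reached at \<open>v\<close>.\<close>
      moreover have "rayleigh A B (?w y) = l" if "?w y \<in> ?E l"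
      proof -
        have "?w y \<bullet> (A *v ?w y) = l * (?w y \<bullet> (B *v ?w y))"
          using that unfolding quadratic_sym_part[where A = A, symmetric] gen_eigenspace_def mem_Collect_eq
          by (metis inner_scaleR_right)
        then show ?thesis using pB[OF w0[of y]] by (simp add: rayleigh_def)
      qed
      ultimately show ?case using r by auto
    qed
  qed
  have "AE y in lborel. \<forall>l\<in>{l. ?E l \<noteq> {0}}. ?w y \<notin> ?E l"
    using avoid finite_gen_eigenvalues[OF transpose_sym_part B]
    by (intro AE_finite_allI) auto
  then show ?thesis
    by eventually_elim (use w0 in \<open>simp add: in_no_eigenspace_iff_finite\<close>)
qed

text \<open>A step defined also where the algorithm stops, with the closed-form step length; its
  measurability is shown below.\<close>

definition next_iterate_formula ::
    "real ^ 'n ^ 'n \<Rightarrow> real ^ 'n ^ 'n \<Rightarrow> real ^ 'n \<Rightarrow> real ^ 'n \<Rightarrow> real ^ 'n" where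
  "next_iterate_formula A B v y =
    (let x = search_dir B v y; w = v + opt_step_formula A B v x *\<^sub>R x in w /\<^sub>R norm_wrt B w)"

lemma next_iterate_eq_formula:
  assumes "sym_pos_def B" "v \<noteq> 0" "\<not> stops A v (search_dir B v y)"
  shows "next_iterate A B v (search_dir B v y) = next_iterate_formula A B v y"
  by (simp add: next_iterate_def next_iterate_formula_def Let_def
      opt_step_eq_formula[OF assms(1,2) search_dir_orthogonal assms(3)])

lemma AE_next_iterate_in_no_eigenspace:
  fixes A B :: "real ^ 'n ^ 'n"
  assumes B: "sym_pos_def B" and dim: "dim (G_max A B \<union> {0}) < CARD('n) - 1"
    and v: "in_no_eigenspace A B v"
  shows "AE y in lborel. \<not> stops A v (search_dir B v y) \<and>
    in_no_eigenspace A B (next_iterate_formula A B v y)"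
  using AE_not_stops[OF v] AE_optimal_point_in_no_eigenspace[OF assms]
proof eventually_elim
  case (elim y)
  let ?w = "v + opt_step A B v (search_dir B v y) *\<^sub>R search_dir B v y"
  have "inverse (norm_wrt B ?w) \<noteq> 0"
    using norm_wrt_pos[OF B in_no_eigenspaceD(1)[OF elim(2)]] by simp
  from in_no_eigenspace_scaleR[OF this elim(2)]
  have "in_no_eigenspace A B (next_iterate A B v (search_dir B v y))"
    by (simp add: next_iterate_def Let_def)
  then show ?case
    using next_iterate_eq_formula[OF B in_no_eigenspaceD(1)[OF v] elim(1)] elim(1) by simp
qed

text \<open>If an eigenspace were the whole space, the Rayleigh quotient would be constant and
  \<open>G_max\<close> together with 0 would be the whole space, against \<open>dim\<close>. So only
  finitely many proper subspaces have to be avoided.\<close>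

lemma AE_initial_in_no_eigenspace:
  fixes A B :: "real ^ 'n ^ 'n"
  assumes B: "sym_pos_def B" and dim: "dim (G_max A B \<union> {0}) < CARD('n) - 1"
  shows "AE u in lborel. in_no_eigenspace A B (u /\<^sub>R norm_wrt B u)"
proof -
  let ?E = "gen_eigenspace (sym_part A) B"
  have proper: "dim (?E l) < DIM(real ^ 'n)" for l
  proof (rule ccontr)
    assume "\<not> ?thesis"
    then have "dim (?E l) = DIM(real ^ 'n)" using dim_subset_UNIV[of "?E l"] by simp
    then have E: "?E l = UNIV"
      using dim_eq_full[of "?E l"] span_eq_iff[of "?E l"] subspace_gen_eigenspace by blast
    have r: "rayleigh A B v = l" if "v \<noteq> 0" for v
    proof -
      have "sym_part A *v v = l *\<^sub>R (B *v v)" using E by (auto simp: gen_eigenspace_def)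
      then have "v \<bullet> (A *v v) = l * (v \<bullet> (B *v v))"
        unfolding quadratic_sym_part[where A = A, symmetric] by simp
      moreover have "v \<bullet> (B *v v) > 0" using B that by (simp add: sym_pos_def_def)
      ultimately show ?thesis by (simp add: rayleigh_def)
    qed
    obtain e :: "real ^ 'n" where "e \<noteq> 0" by (metis axis_eq_0_iff zero_neq_one)
    then have "rayleigh_max A B = l"
      unfolding rayleigh_max_def using r by (intro Greatest_equality) auto
    then show False using dim E unfolding G_max_def dim_gen_eigenvectors by simp
  qed
  have "AE u in lborel. \<forall>l\<in>{l. ?E l \<noteq> {0}}. u \<notin> ?E l"
    using AE_lborel_notin_subspace[OF proper] finite_gen_eigenvalues[OF transpose_sym_part B]
    by (intro AE_finite_allI) auto
  moreover have "AE u in lborel. u \<notin> {0::real ^ 'n}"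
    by (rule AE_lborel_notin_subspace) simp
  ultimately show ?thesis
  proof eventually_elim
    case (elim u)
    then have "in_no_eigenspace A B u" by (simp add: in_no_eigenspace_iff_finite)
    moreover have "inverse (norm_wrt B u) \<noteq> 0" using norm_wrt_pos[OF B, of u] elim(2) by auto
    ultimately show ?case by (rule in_no_eigenspace_scaleR[rotated])
  qed
qed

section \<open>Measurability, and runs as functions of the samples\<close>

lemma borel_measurable_matrix_vector_mult [measurable (raw)]:
  fixes f :: "'a \<Rightarrow> real ^ 'n"
  assumes "f \<in> borel_measurable M"
  shows "(\<lambda>x. A *v f x) \<in> borel_measurable M"
  using assms
  by (rule measurable_compose)
    (intro borel_measurable_continuous_onI linear_continuous_on matrix_vector_mul_bounded_linear)

lemma borel_measurable_search_dir [measurable (raw)]: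
  assumes [measurable]: "f \<in> borel_measurable M" "g \<in> borel_measurable M"
  shows "(\<lambda>x. search_dir B (f x) (g x)) \<in> borel_measurable M"
  unfolding search_dir_def tangent_proj_def by measurable

lemma borel_measurable_opt_step_formula [measurable (raw)]:
  assumes [measurable]: "f \<in> borel_measurable M" "g \<in> borel_measurable M"
  shows "(\<lambda>x. opt_step_formula A B (f x) (g x)) \<in> borel_measurable M"
  unfolding opt_step_formula_def step_value_def Let_def by measurable

lemma borel_measurable_next_iterate_formula [measurable (raw)]:
  assumes [measurable]: "f \<in> borel_measurable M" "g \<in> borel_measurable M"
  shows "(\<lambda>x. next_iterate_formula A B (f x) (g x)) \<in> borel_measurable M"
  unfolding next_iterate_formula_def norm_wrt_def Let_def by measurable

text \<open>The origin and finitely many closed subspaces are excluded; the defining quantifier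
  ranges over uncountably many \<open>l\<close>.\<close>

lemma pred_in_no_eigenspace [measurable (raw)]:
  assumes B: "sym_pos_def B" and [measurable]: "f \<in> borel_measurable M"
  shows "Measurable.pred M (\<lambda>x. in_no_eigenspace A B (f x))"
proof -
  have [measurable]: "gen_eigenspace (sym_part A) B l \<in> sets borel" for l
    using closed_subspace[OF subspace_gen_eigenspace] by (rule borel_closed)
  show ?thesis
    unfolding in_no_eigenspace_iff_finite
    using finite_gen_eigenvalues[OF transpose_sym_part B] by measurable
qed

text \<open>A version of \<open>iterate\<close> that never stops. Component 0 of \<open>f\<close> is
  the initial sample and component \<open>Suc k\<close> the direction sample of iteration
  \<open>k\<close>, so \<open>run A B k\<close> reads only components 0 to \<open>k\<close>.\<close>

primrec run ::
    "real ^ 'n ^ 'n \<Rightarrow> real ^ 'n ^ 'n \<Rightarrow> nat \<Rightarrow> (nat \<Rightarrow> real ^ 'n) \<Rightarrow> real ^ 'n" where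
  "run A B 0 f = f 0 /\<^sub>R norm_wrt B (f 0)"
| "run A B (Suc k) f = next_iterate_formula A B (run A B k f) (f (Suc k))"

lemma measurable_run: "run A B k \<in> borel_measurable (PiM {..k} (\<lambda>_. borel))"
proof -
  \<comment> \<open>The index set \<open>{..k}\<close> stays fixed while \<open>j\<close> varies, so
    the induction never changes the product space.\<close>
  have "j \<le> k \<Longrightarrow> run A B j \<in> borel_measurable (PiM {..k} (\<lambda>_. borel))" for j
  proof (induction j)
    case 0
    have [measurable]: "(\<lambda>f. f 0) \<in> borel_measurable (PiM {..k} (\<lambda>_. borel :: (real ^ 'a) measure))"
      by (rule measurable_component_singleton) simp
    show ?case unfolding run.simps norm_wrt_def by measurable
  next
    case (Suc j)
    then have [measurable]: "run A B j \<in> borel_measurable (PiM {..k} (\<lambda>_. borel))" by simp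
    have [measurable]: "(\<lambda>f. f (Suc j)) \<in> borel_measurable (PiM {..k} (\<lambda>_. borel :: (real ^ 'a) measure))"
      by (rule measurable_component_singleton) (use Suc in simp)
    show ?case unfolding run.simps by measurable
  qed
  then show ?thesis by simp
qed

lemma run_restrict: "j \<le> k \<Longrightarrow> run A B j (restrict f {..k}) = run A B j f"
  by (induction j) auto

text \<open>At nonzero iterates where the test fails, the closed-form step is the step of the
  algorithm, so the two runs agree inductively.\<close>

lemma iterate_eq_run:
  assumes B: "sym_pos_def B"
    and good: "\<And>j. j \<le> k \<Longrightarrow> in_no_eigenspace A B (run A B j f)"
    and cont: "\<And>j. j < k \<Longrightarrow> \<not> stops A (run A B j f) (search_dir B (run A B j f) (f (Suc j)))"
  shows "iterate A B (f 0) (\<lambda>k. f (Suc k)) k = Some (run A B k f)"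
  using good cont
proof (induction k)
  case (Suc k)
  have "iterate A B (f 0) (\<lambda>k. f (Suc k)) k = Some (run A B k f)" using Suc by simp
  moreover have "next_iterate A B (run A B k f) (search_dir B (run A B k f) (f (Suc k)))
      = run A B (Suc k) f"
    unfolding run.simps
    by (rule next_iterate_eq_formula[OF B in_no_eigenspaceD(1)[OF Suc.prems(1)] Suc.prems(2)]) simp_all
  ultimately show ?case using Suc.prems(2)[of k] by (simp add: Let_def)
qed simp

section \<open>Absolute continuity and independence of the samples\<close>

lemma distributed_lborel_AE:
  assumes X: "distributed M lborel X f" and P: "AE x in lborel. P x"
  shows "AE \<omega> in M. P (X \<omega>)"
proof -
  have [measurable]: "X \<in> M \<rightarrow>\<^sub>M lborel" "f \<in> borel_measurable lborel"
    using X by (auto simp: distributed_def)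
  have "AE x in density lborel f. P x"
    unfolding AE_density[OF \<open>f \<in> borel_measurable lborel\<close>] using P by eventually_elim simp
  then have "AE x in distr M lborel X. P x"
    unfolding distributed_distr_eq_density[OF X] .
  then show ?thesis by (rule AE_distrD[rotated]) measurable
qed

text \<open>Independence makes the joint law a product, and by Fubini a set whose sections are all
  null is null.\<close>

lemma (in prob_space) AE_indep_pair:
  assumes ind: "indep_var borel X borel Y" and Y: "distributed M lborel Y f"
    and P[measurable]: "Measurable.pred (borel \<Otimes>\<^sub>M borel) (\<lambda>(x, y). P x y)"
    and ae: "\<And>x. AE y in lborel. P x y"
  shows "AE \<omega> in M. P (X \<omega>) (Y \<omega>)"
proof -
  have [measurable]: "random_variable borel X" "random_variable borel Y"
    using ind by (auto dest: indep_var_rv1 indep_var_rv2)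
  interpret X: prob_space "distr M borel X" by (rule prob_space_distr) measurable
  interpret Y: prob_space "distr M borel Y" by (rule prob_space_distr) measurable
  interpret XY: pair_prob_space "distr M borel X" "distr M borel Y" ..
  have "AE y in distr M borel Y. P x y" for x
    by (subst AE_distr_iff) (use distributed_lborel_AE[OF Y ae] in simp_all)
  then have "AE x in distr M borel X. AE y in distr M borel Y. P x y" by simp
  then have "AE z in distr M borel X \<Otimes>\<^sub>M distr M borel Y. case z of (x, y) \<Rightarrow> P x y"
    using P by (intro XY.AE_pair_measure) (simp_all add: pred_def space_pair_measure)
  moreover have "distr M borel X \<Otimes>\<^sub>M distr M borel Y = distr M (borel \<Otimes>\<^sub>M borel) (\<lambda>\<omega>. (X \<omega>, Y \<omega>))"
    using ind unfolding indep_var_distribution_eq by blast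
  ultimately have "AE z in distr M (borel \<Otimes>\<^sub>M borel) (\<lambda>\<omega>. (X \<omega>, Y \<omega>)). case z of (x, y) \<Rightarrow> P x y"
    by (simp only:)
  then show ?thesis by (subst (asm) AE_distr_iff) simp_all
qed

theorem theorem4p6:
  fixes A B :: "real ^ 'n ^ 'n"
    and M :: "'w measure"
    and v_sample :: "'w \<Rightarrow> real ^ 'n"
    and x_sample :: "nat \<Rightarrow> 'w \<Rightarrow> real ^ 'n"
  assumes "sym_pos_def B"
    and "prob_space M"
    and "distributed M lborel v_sample std_gaussian_density"
    and "\<And>k. distributed M lborel (x_sample k) std_gaussian_density"
    and "prob_space.indep_vars M (\<lambda>_. borel)
           (\<lambda>j. case j of 0 \<Rightarrow> v_sample | Suc k \<Rightarrow> x_sample k) UNIV"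
    and "dim (G_max A B \<union> {0}) < CARD('n) - 1"
  shows "(AE \<omega> in M. \<forall>k. \<exists>v.
            iterate A B (v_sample \<omega>) (\<lambda>k. x_sample k \<omega>) k = Some v \<and>
            \<not> is_gen_eigenvector A B v) \<and>
         (AE \<omega> in M. \<not> terminates A B (v_sample \<omega>) (\<lambda>k. x_sample k \<omega>))"
proof -
  note B = assms(1) and dim = assms(6)
  interpret prob_space M by fact
  \<comment> \<open>All samples in one sequence, the initial one first, which shifts the direction
    samples by one.\<close>
  define Z where "Z = (\<lambda>j. case j of 0 \<Rightarrow> v_sample | Suc k \<Rightarrow> x_sample k)"
  define V where "V k \<omega> = run A B k (\<lambda>j. Z j \<omega>)" for k \<omega>
  have Z: "Z 0 = v_sample" "\<And>k. Z (Suc k) = x_sample k" by (simp_all add: Z_def)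
  have ind: "indep_vars (\<lambda>_. borel) Z UNIV" using assms(5) by (simp add: Z_def)
  \<comment> \<open>The iterate is a function of components up to \<open>k\<close>, the next
    direction of component \<open>Suc k\<close>; disjoint blocks of an independent family are
    independent.\<close>
  have indV: "indep_var borel (V k) borel (x_sample k)" for k
  proof -
    have "indep_var borel (run A B k \<circ> (\<lambda>\<omega>. restrict (\<lambda>i. Z i \<omega>) {..k}))
        borel ((\<lambda>f. f (Suc k)) \<circ> (\<lambda>\<omega>. restrict (\<lambda>i. Z i \<omega>) {Suc k}))"
      by (rule indep_var_compose[OF indep_var_restrict[OF ind] measurable_run]) auto
    moreover have "run A B k \<circ> (\<lambda>\<omega>. restrict (\<lambda>i. Z i \<omega>) {..k}) = V k"
      by (simp add: fun_eq_iff V_def run_restrict)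
    moreover have "(\<lambda>f. f (Suc k)) \<circ> (\<lambda>\<omega>. restrict (\<lambda>i. Z i \<omega>) {Suc k}) = x_sample k"
      by (simp add: fun_eq_iff Z)
    ultimately show ?thesis by simp
  qed
  have "AE \<omega> in M. in_no_eigenspace A B (V 0 \<omega>)"
    using distributed_lborel_AE[OF assms(3) AE_initial_in_no_eigenspace[OF B dim]]
    by (simp add: V_def Z)
  moreover have "AE \<omega> in M. \<forall>k. in_no_eigenspace A B (V k \<omega>) \<longrightarrow>
      \<not> stops A (V k \<omega>) (search_dir B (V k \<omega>) (x_sample k \<omega>)) \<and> in_no_eigenspace A B (V (Suc k) \<omega>)"
    unfolding AE_all_countable
  proof
    fix k
    \<comment> \<open>As an implication the statement holds almost everywhere in \<open>y\<close>
      for every fixed \<open>v\<close>, as \<open>AE_indep_pair\<close> requires.\<close>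
    let ?P = "\<lambda>v y. in_no_eigenspace A B v \<longrightarrow>
      \<not> stops A v (search_dir B v y) \<and> in_no_eigenspace A B (next_iterate_formula A B v y)"
    note [measurable] = pred_in_no_eigenspace[OF B]
    have meas: "Measurable.pred (borel \<Otimes>\<^sub>M borel) (\<lambda>(v, y). ?P v y)"
      unfolding stops_def by measurable
    have "AE \<omega> in M. ?P (V k \<omega>) (x_sample k \<omega>)"
      using AE_next_iterate_in_no_eigenspace[OF B dim]
      by (intro AE_indep_pair[OF indV assms(4) meas]) auto
    then show "AE \<omega> in M. in_no_eigenspace A B (V k \<omega>) \<longrightarrow>
        \<not> stops A (V k \<omega>) (search_dir B (V k \<omega>) (x_sample k \<omega>)) \<and> in_no_eigenspace A B (V (Suc k) \<omega>)"
      by (simp add: V_def Z)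
  qed
  ultimately have "AE \<omega> in M. \<forall>k. iterate A B (v_sample \<omega>) (\<lambda>k. x_sample k \<omega>) k = Some (V k \<omega>) \<and>
      in_no_eigenspace A B (V k \<omega>) \<and> \<not> stops A (V k \<omega>) (search_dir B (V k \<omega>) (x_sample k \<omega>))"
  proof eventually_elim
    case (elim \<omega>)
    \<comment> \<open>Outside one null set for all \<open>k\<close>, the implications carry the
      invariant from each iterate to the next.\<close>
    have good: "in_no_eigenspace A B (V k \<omega>)" for k
      by (induction k) (use elim in auto)
    then have cont: "\<not> stops A (V k \<omega>) (search_dir B (V k \<omega>) (x_sample k \<omega>))" for k
      using elim by blast
    have "iterate A B (v_sample \<omega>) (\<lambda>k. x_sample k \<omega>) k = Some (V k \<omega>)" for k
      using iterate_eq_run[OF B, of k A "\<lambda>j. Z j \<omega>"] good cont by (simp add: V_def Z)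
    then show ?case using good cont by simp
  qed
  then show ?thesis
  proof (intro conjI)
    assume *: "AE \<omega> in M. \<forall>k. iterate A B (v_sample \<omega>) (\<lambda>k. x_sample k \<omega>) k = Some (V k \<omega>) \<and>
      in_no_eigenspace A B (V k \<omega>) \<and> \<not> stops A (V k \<omega>) (search_dir B (V k \<omega>) (x_sample k \<omega>))"
    show "AE \<omega> in M. \<forall>k. \<exists>v. iterate A B (v_sample \<omega>) (\<lambda>k. x_sample k \<omega>) k = Some v \<and>
        \<not> is_gen_eigenvector A B v"
      using * by eventually_elim (auto dest: in_no_eigenspaceD(2))
    show "AE \<omega> in M. \<not> terminates A B (v_sample \<omega>) (\<lambda>k. x_sample k \<omega>)"
      using * by eventually_elim (auto simp: terminates_def)
  qed
qed

end
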